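(* Let $Q\in\mathbb{R}^{d\times d}$ be an orthogonal matrix, i.e. $Q^TQ=I_d$. If $(Y,B,H)$, with $Y\in\mathbb{R}^{n\times d}$, $B=(B^1,\dots,B^t)$, $B^s\in\mathbb{R}^{d\times d_s^h}$, and $H$ the collection of autoencoder parameters, is an optimal solution (global minimizer) of the problem $$\min_{Y,B,H}\ O(Y,B,H)=\sum_{s=1}^t\|X^s-\tilde X^s\|_F^2+\alpha\sum_{s=1}^t\|I^s(H^s-YB^s)\|_F^2+\beta\,\mathrm{tr}(Y^TLY)+\lambda\,R(Y,B,H),$$ then $(Y',B',H')$ with $Y'=YQ$, $B'^s=Q^TB^s$ for every $s=1,\dots,t$, and $H'=H$ is also an optimal solution of the same problem.
   Context: Setting: a multiplex network on $n$ nodes with $t$ views. For each view $s\in\{1,\dots,t\}$: - $X^s\in\mathbb{R}^{n\times d_s}$ is the given feature matrix, whose $i$-th row $x_i^s$ is the feature of node $i$ in view $s$; some features may be missing. $I^s\in\mathbb{R}^{n\times n}$ is the given diagonal matrix with $I^s_{ii}=0$ if $x_i^s$ is missing and $I^s_{ii}=1$ otherwise. - There is one autoencoder per view, with $K$ encoder layers and $K$ decoder layers of fixed sizes, and a fixed nonlinear activation function $\sigma:\mathbb{R}\to\mathbb{R}$ applied entrywise. The encoder maps $x$ to $h_K$, where $h_1=\sigma(W_1^{(en)}x+b_1^{(en)})$ and $h_k=\sigma(W_k^{(en)}h_{k-1}+b_k^{(en)})$ for $k=2,\dots,K$. The decoder has the same layered form (with parameters $W_k^{(de)},b_k^{(de)}$)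 and maps $h_K\in\mathbb{R}^{d_s^h}$ to a reconstruction $\tilde x\in\mathbb{R}^{d_s}$. The symbol $H$ denotes the collection of all weights and biases of the autoencoders of all views. - $H^s\in\mathbb{R}^{n\times d_s^h}$ is the matrix of deep representations in view $s$: its $i$-th row is the encoder output for $x_i^s$, and is $0$ if $x_i^s$ is missing. $\tilde X^s\in\mathbb{R}^{n\times d_s}$ is the matrix of reconstructed features (decoder outputs). Both $H^s$ and $\tilde X^s$ are functions of $H$ and the given data only; they do not depend on $Y$ or $B$. - $E^s\in\{0,1\}^{n\times n}$ is the symmetric matrix with $E^s_{ij}=1$ iff nodes $i,j$ are linked in view $s$, and $P^s=w_1E^s+w_2(E^s)^2+\dots+w_l(E^s)^l$ for a fixed order $l$ and fixed real weights $w_1,\dots,w_l$. Put $P=\sum_{s=1}^tP^s$, let $D$ be the diagonal matrix with $D_{ii}=\sum_{j=1}^nP_{ij}$, and let $L=D-P\in\mathbb{R}^{n\times n}$ (graph Laplacian). $Y\in\mathbb{R}^{n\times d}$ is the node embedding matrix (row $i$ is the embedding of node $i$), and $B^s\in\mathbb{R}^{d\times d_s^h}$ is the basis matrix of view $s$. The regularizer is the sum of squared Frobenius norms $R(Y,B,H)=\|Y\|_F^2+\sum_{s=1}^t\|B^s\|_F^2+\|H\|_F^2$, where $\|H\|_F^2$ denotes the sum of squares of all entries of all autoencoder parameters. $\alpha,\beta,\lambda$ are fixed real trade-off parameters. The minimization is over all $Y$, all $B^1,\dots,B^t$ and all autoencoder parameters $H$, without constraints. $\|\cdot\|_F$ is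 the Frobenius norm, $\mathrm{tr}$ the trace, $I_d$ the $d\times d$ identity matrix. *)

theory Defs
  imports Complex_Main "Jordan_Normal_Form.Matrix"
begin

definition mat_trace :: "real mat \<Rightarrow> real" where
  "mat_trace A = (\<Sum>i<dim_row A. A $$ (i, i))"

definition frobenius_norm :: "real mat \<Rightarrow> real" where
  "frobenius_norm A = sqrt (\<Sum>i<dim_row A. \<Sum>j<dim_col A. (A $$ (i, j))\<^sup>2)"

definition sum_squares_vec :: "real vec \<Rightarrow> real" where
  "sum_squares_vec v = (\<Sum>i<dim_vec v. (v $ i)\<^sup>2)"

text \<open>The given data of the optimization problem. Nodes are numbered 0, ..., n - 1 (as the rows of
  a matrix are), views 1, ..., t, and layers 1, ..., K. \<open>enc_size M s k\<close> is the length of the output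
  of encoder layer k in view s, and \<open>enc_size M s 0\<close> is the length of its input; likewise for
  \<open>dec_size\<close>. In the row of a missing feature, \<open>feat\<close> contains arbitrary real placeholders.\<close>

record multiplex =
  nodes :: nat
  views :: nat
  emb_dim :: nat
  depth :: nat
  enc_size :: "nat \<Rightarrow> nat \<Rightarrow> nat"
  dec_size :: "nat \<Rightarrow> nat \<Rightarrow> nat"
  activation :: "real \<Rightarrow> real"
  feat :: "nat \<Rightarrow> real mat"
  missing :: "nat \<Rightarrow> nat \<Rightarrow> bool"
  linked :: "nat \<Rightarrow> nat \<Rightarrow> nat \<Rightarrow> bool"
  prox_order :: nat
  weight :: "nat \<Rightarrow> real"
  alpha :: real
  beta :: real
  lambda :: real

text \<open>\<open>feat_dim M s\<close> is $d_s$ and \<open>rep_dim M s\<close> is $d_s^h$.\<close>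

abbreviation feat_dim :: "multiplex \<Rightarrow> nat \<Rightarrow> nat" where
  "feat_dim M s \<equiv> enc_size M s 0"

abbreviation rep_dim :: "multiplex \<Rightarrow> nat \<Rightarrow> nat" where
  "rep_dim M s \<equiv> enc_size M s (depth M)"

definition multiplex_network :: "multiplex \<Rightarrow> bool" where
  "multiplex_network M \<longleftrightarrow>
     1 \<le> depth M \<and>
     \<not> linear (activation M) \<and>
     (\<forall>s\<in>{1..views M}.
        dec_size M s 0 = rep_dim M s \<and>
        dec_size M s (depth M) = feat_dim M s \<and>
        feat M s \<in> carrier_mat (nodes M) (feat_dim M s) \<and>
        (\<forall>i<nodes M. \<forall>j<nodes M. linked M s i j \<longleftrightarrow> linked M s j i))"

text \<open>Parameters of the autoencoder of one view. Only the entries with layer index 1, ..., K are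
  used.\<close>

record autoencoder =
  enc_weight :: "nat \<Rightarrow> real mat"
  enc_bias :: "nat \<Rightarrow> real vec"
  dec_weight :: "nat \<Rightarrow> real mat"
  dec_bias :: "nat \<Rightarrow> real vec"

definition autoencoder_params :: "multiplex \<Rightarrow> nat \<Rightarrow> autoencoder \<Rightarrow> bool" where
  "autoencoder_params M s A \<longleftrightarrow>
     (\<forall>k\<in>{1..depth M}.
        enc_weight A k \<in> carrier_mat (enc_size M s k) (enc_size M s (k - 1)) \<and>
        enc_bias A k \<in> carrier_vec (enc_size M s k) \<and>
        dec_weight A k \<in> carrier_mat (dec_size M s k) (dec_size M s (k - 1)) \<and>
        dec_bias A k \<in> carrier_vec (dec_size M s k))"

fun layer_output ::
  "(real \<Rightarrow> real) \<Rightarrow> (nat \<Rightarrow> real mat) \<Rightarrow> (nat \<Rightarrow> real vec) \<Rightarrow> nat \<Rightarrow> real vec \<Rightarrow> real vec" where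
  "layer_output \<sigma> W b 0 x = x"
| "layer_output \<sigma> W b (Suc k) x =
     map_vec \<sigma> (W (Suc k) *\<^sub>v layer_output \<sigma> W b k x + b (Suc k))"

definition encoder :: "multiplex \<Rightarrow> autoencoder \<Rightarrow> real vec \<Rightarrow> real vec" where
  "encoder M A = layer_output (activation M) (enc_weight A) (enc_bias A) (depth M)"

definition decoder :: "multiplex \<Rightarrow> autoencoder \<Rightarrow> real vec \<Rightarrow> real vec" where
  "decoder M A = layer_output (activation M) (dec_weight A) (dec_bias A) (depth M)"

text \<open>A family of autoencoders, one per view, is the variable \<open>H\<close> below. The matrices $H^s$ and
  $\tilde X^s$ follow; the row of $\tilde X^s$ for a missing feature is the decoder output for the
  corresponding (zero) row of $H^s$.\<close>

definition rep_mat :: "multiplex \<Rightarrow> (nat \<Rightarrow> autoencoder) \<Rightarrow> nat \<Rightarrow> real mat" where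
  "rep_mat M H s = mat_of_rows (rep_dim M s)
     (map (\<lambda>i. if missing M s i then 0\<^sub>v (rep_dim M s) else encoder M (H s) (row (feat M s) i))
       [0..<nodes M])"

definition recon_mat :: "multiplex \<Rightarrow> (nat \<Rightarrow> autoencoder) \<Rightarrow> nat \<Rightarrow> real mat" where
  "recon_mat M H s = mat_of_rows (feat_dim M s)
     (map (\<lambda>i. decoder M (H s) (row (rep_mat M H s) i)) [0..<nodes M])"

definition indicator_mat :: "multiplex \<Rightarrow> nat \<Rightarrow> real mat" where
  "indicator_mat M s = mat_diag (nodes M) (\<lambda>i. if missing M s i then 0 else 1)"

definition adjacency_mat :: "multiplex \<Rightarrow> nat \<Rightarrow> real mat" where
  "adjacency_mat M s = mat (nodes M) (nodes M) (\<lambda>(i, j). if linked M s i j then 1 else 0)"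

definition proximity_mat :: "multiplex \<Rightarrow> nat \<Rightarrow> real mat" where
  "proximity_mat M s = mat (nodes M) (nodes M)
     (\<lambda>ij. \<Sum>m=1..prox_order M. weight M m * (adjacency_mat M s ^\<^sub>m m) $$ ij)"

definition total_proximity_mat :: "multiplex \<Rightarrow> real mat" where
  "total_proximity_mat M = mat (nodes M) (nodes M)
     (\<lambda>ij. \<Sum>s=1..views M. proximity_mat M s $$ ij)"

definition degree_mat :: "multiplex \<Rightarrow> real mat" where
  "degree_mat M = mat_diag (nodes M) (\<lambda>i. \<Sum>j<nodes M. total_proximity_mat M $$ (i, j))"

definition laplacian :: "multiplex \<Rightarrow> real mat" where
  "laplacian M = degree_mat M - total_proximity_mat M"

definition params_sum_squares :: "multiplex \<Rightarrow> (nat \<Rightarrow> autoencoder) \<Rightarrow> real" where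
  "params_sum_squares M H = (\<Sum>s=1..views M. \<Sum>k=1..depth M.
     (frobenius_norm (enc_weight (H s) k))\<^sup>2 + sum_squares_vec (enc_bias (H s) k) +
     (frobenius_norm (dec_weight (H s) k))\<^sup>2 + sum_squares_vec (dec_bias (H s) k))"

definition regularizer ::
  "multiplex \<Rightarrow> real mat \<Rightarrow> (nat \<Rightarrow> real mat) \<Rightarrow> (nat \<Rightarrow> autoencoder) \<Rightarrow> real" where
  "regularizer M Y B H =
     (frobenius_norm Y)\<^sup>2 + (\<Sum>s=1..views M. (frobenius_norm (B s))\<^sup>2) + params_sum_squares M H"

definition objective ::
  "multiplex \<Rightarrow> real mat \<Rightarrow> (nat \<Rightarrow> real mat) \<Rightarrow> (nat \<Rightarrow> autoencoder) \<Rightarrow> real" where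
  "objective M Y B H =
     (\<Sum>s=1..views M. (frobenius_norm (feat M s - recon_mat M H s))\<^sup>2) +
     alpha M * (\<Sum>s=1..views M.
       (frobenius_norm (indicator_mat M s * (rep_mat M H s - Y * B s)))\<^sup>2) +
     beta M * mat_trace (transpose_mat Y * laplacian M * Y) +
     lambda M * regularizer M Y B H"

text \<open>Since the types of \<open>Y\<close>, \<open>B\<close> and \<open>H\<close> do not fix dimensions, the domain of the unconstrained
  minimization is given by a predicate.\<close>

definition admissible ::
  "multiplex \<Rightarrow> real mat \<Rightarrow> (nat \<Rightarrow> real mat) \<Rightarrow> (nat \<Rightarrow> autoencoder) \<Rightarrow> bool" where
  "admissible M Y B H \<longleftrightarrow>
     Y \<in> carrier_mat (nodes M) (emb_dim M) \<and>
     (\<forall>s\<in>{1..views M}.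
        B s \<in> carrier_mat (emb_dim M) (rep_dim M s) \<and> autoencoder_params M s (H s))"

definition optimal_solution ::
  "multiplex \<Rightarrow> real mat \<Rightarrow> (nat \<Rightarrow> real mat) \<Rightarrow> (nat \<Rightarrow> autoencoder) \<Rightarrow> bool" where
  "optimal_solution M Y B H \<longleftrightarrow>
     is_arg_min (\<lambda>(Y, B, H). objective M Y B H) (\<lambda>(Y, B, H). admissible M Y B H) (Y, B, H)"

end

(* The objective is invariant under the substitution, because Q Q^T = I as well: the product
   (Y Q) (Q^T B^s) is Y B^s, the trace term and the squared norms of Y and B^s are traces,
   hence unchanged by cyclicity, and no other term involves Y or B. *)

theory Submission
  imports Defs "Jordan_Normal_Form.Determinant"
begin

lemma mat_trace_mult_commute:
  assumes "A \<in> carrier_mat m k" and "B \<in> carrier_mat k m"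
  shows "mat_trace (A * B) = mat_trace (B * A)"
proof -
  have "mat_trace (A * B) = (\<Sum>i<m. \<Sum>j<k. A $$ (i, j) * B $$ (j, i))"
    using assms by (auto simp: mat_trace_def scalar_prod_def atLeast0LessThan intro!: sum.cong)
  also have "\<dots> = (\<Sum>j<k. \<Sum>i<m. B $$ (j, i) * A $$ (i, j))"
    by (subst sum.swap) (simp add: mult.commute)
  also have "\<dots> = mat_trace (B * A)"
    using assms by (auto simp: mat_trace_def scalar_prod_def atLeast0LessThan intro!: sum.cong)
  finally show ?thesis .
qed

text \<open>Cyclicity carries \<open>Q\<close> from the right end to the front, where it meets
  \<open>P\<close>; hence the hypothesis is \<open>Q * P = 1\<close>, in this order.\<close>

lemma mat_trace_conj:
  assumes "P \<in> carrier_mat d d" and "Q \<in> carrier_mat d d" and "A \<in> carrier_mat d d"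
    and "Q * P = 1\<^sub>m d"
  shows "mat_trace (P * A * Q) = mat_trace A"
proof -
  have "mat_trace (P * A * Q) = mat_trace (Q * (P * A))"
    using assms by (intro mat_trace_mult_commute) auto
  also have "Q * (P * A) = A"
    using assoc_mult_mat[OF assms(2,1,3)] assms(3,4) by simp
  finally show ?thesis .
qed

text \<open>The diagonal of the Gram matrix A^T A holds the squared column norms. In this form the
  regularizer can be treated by the same matrix algebra as the Laplacian term.\<close>

lemma frobenius_norm_square: "(frobenius_norm A)\<^sup>2 = mat_trace (transpose_mat A * A)"
proof -
  have "(frobenius_norm A)\<^sup>2 = (\<Sum>i<dim_row A. \<Sum>j<dim_col A. (A $$ (i, j))\<^sup>2)"
    unfolding frobenius_norm_def by (intro real_sqrt_pow2 sum_nonneg) auto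
  also have "\<dots> = (\<Sum>j<dim_col A. \<Sum>i<dim_row A. (A $$ (i, j))\<^sup>2)"
    by (rule sum.swap)
  also have "\<dots> = mat_trace (transpose_mat A * A)"
    by (auto simp: mat_trace_def scalar_prod_def atLeast0LessThan power2_eq_square intro!: sum.cong)
  finally show ?thesis .
qed

text \<open>Regrouping exhibits the left-hand matrix as Y^T L Y conjugated by \<open>Q\<close>, and
  conjugation preserves the trace. \<open>L\<close> is left general so that the identity matrix can
  be inserted as well as the Laplacian.\<close>

lemma mat_trace_quadratic_form_orthogonal:
  assumes Y: "Y \<in> carrier_mat n d" and L: "L \<in> carrier_mat n n" and Q: "Q \<in> carrier_mat d d"
    and QQt: "Q * transpose_mat Q = 1\<^sub>m d"
  shows "mat_trace (transpose_mat (Y * Q) * L * (Y * Q)) = mat_trace (transpose_mat Y * L * Y)"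
proof -
  have "transpose_mat (Y * Q) * L * (Y * Q) = transpose_mat Q * (transpose_mat Y * L * Y) * Q"
  proof -
    have Qt: "transpose_mat Q \<in> carrier_mat d d" and Yt: "transpose_mat Y \<in> carrier_mat d n"
      and YtL: "transpose_mat Y * L \<in> carrier_mat d n"
      using Y L Q by auto
    have "transpose_mat Q * transpose_mat Y * L * (Y * Q)
        = transpose_mat Q * (transpose_mat Y * L) * (Y * Q)"
      by (simp only: assoc_mult_mat[OF Qt Yt L])
    also have "\<dots> = transpose_mat Q * (transpose_mat Y * L) * Y * Q"
      by (simp only: assoc_mult_mat[OF mult_carrier_mat[OF Qt YtL] Y Q])
    also have "\<dots> = transpose_mat Q * (transpose_mat Y * L * Y) * Q"
      by (simp only: assoc_mult_mat[OF Qt YtL Y])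
    finally show ?thesis
      by (simp only: transpose_mult[OF Y Q])
  qed
  then show ?thesis
    using Y L Q QQt mat_trace_conj[of "transpose_mat Q" d Q "transpose_mat Y * L * Y"] by simp
qed

lemma frobenius_norm_mult_orthogonal:
  assumes Y: "Y \<in> carrier_mat n d" and Q: "Q \<in> carrier_mat d d"
    and QQt: "Q * transpose_mat Q = 1\<^sub>m d"
  shows "(frobenius_norm (Y * Q))\<^sup>2 = (frobenius_norm Y)\<^sup>2"
proof -
  \<comment> \<open>These equations identify the Gram matrices of \<open>Y\<close> and
    \<open>Y * Q\<close> with quadratic forms in which L is the identity.\<close>
  have "transpose_mat Y * 1\<^sub>m n = transpose_mat Y"
    "transpose_mat (Y * Q) * 1\<^sub>m n = transpose_mat (Y * Q)"
    using Y Q by (auto intro!: right_mult_one_mat)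
  then show ?thesis
    using mat_trace_quadratic_form_orthogonal[OF Y one_carrier_mat Q QQt]
    by (simp only: frobenius_norm_square)
qed

text \<open>Here the two factors meet inside the product, B^T (Q Q^T) B, so already the Gram matrix
  is unchanged, not merely its trace.\<close>

lemma frobenius_norm_orthogonal_mult:
  assumes B: "B \<in> carrier_mat d r" and Q: "Q \<in> carrier_mat d d"
    and QQt: "Q * transpose_mat Q = 1\<^sub>m d"
  shows "(frobenius_norm (transpose_mat Q * B))\<^sup>2 = (frobenius_norm B)\<^sup>2"
proof -
  have "transpose_mat (transpose_mat Q * B) * (transpose_mat Q * B)
      = transpose_mat B * (Q * transpose_mat Q * B)"
  proof -
    have Qt: "transpose_mat Q \<in> carrier_mat d d" and Bt: "transpose_mat B \<in> carrier_mat r d"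
      and QtB: "transpose_mat Q * B \<in> carrier_mat d r"
      using B Q by auto
    have "transpose_mat (transpose_mat Q * B) = transpose_mat B * Q"
      by (simp only: transpose_mult[OF Qt B] transpose_transpose)
    then show ?thesis
      by (simp only: assoc_mult_mat[OF Bt Q QtB] assoc_mult_mat[OF Q Qt B])
  qed
  then show ?thesis
    using B QQt by (simp add: frobenius_norm_square)
qed

text \<open>Admissibility supplies the dimensions under which the products may be regrouped.\<close>

lemma objective_orthogonal_invariant:
  assumes adm: "admissible M Y B H" and Q: "Q \<in> carrier_mat (emb_dim M) (emb_dim M)"
    and QQt: "Q * transpose_mat Q = 1\<^sub>m (emb_dim M)"
  shows "objective M (Y * Q) (\<lambda>s. transpose_mat Q * B s) H = objective M Y B H"
proof -
  have Y: "Y \<in> carrier_mat (nodes M) (emb_dim M)"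
    and B: "\<And>s. s \<in> {1..views M} \<Longrightarrow> B s \<in> carrier_mat (emb_dim M) (rep_dim M s)"
    using adm by (auto simp: admissible_def)
  have Qt: "transpose_mat Q \<in> carrier_mat (emb_dim M) (emb_dim M)"
    using Q by simp
  have L: "laplacian M \<in> carrier_mat (nodes M) (nodes M)"
    by (simp add: laplacian_def degree_mat_def total_proximity_mat_def minus_carrier_mat)
  \<comment> \<open>The dimensions of \<open>B s\<close> are known only for the actual views, so the
    identities are applied under the sums by congruence.\<close>
  have YB: "Y * Q * (transpose_mat Q * B s) = Y * B s" if "s \<in> {1..views M}" for s
  proof -
    have "Y * Q * (transpose_mat Q * B s) = Y * (Q * transpose_mat Q * B s)"
      using assoc_mult_mat[OF Y Q mult_carrier_mat[OF Qt B[OF that]]]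
        assoc_mult_mat[OF Q Qt B[OF that]] by simp
    then show ?thesis
      using B[OF that] QQt by simp
  qed
  have "(\<Sum>s=1..views M.
        (frobenius_norm (indicator_mat M s * (rep_mat M H s - Y * Q * (transpose_mat Q * B s))))\<^sup>2) =
      (\<Sum>s=1..views M. (frobenius_norm (indicator_mat M s * (rep_mat M H s - Y * B s)))\<^sup>2)"
    by (rule sum.cong[OF refl]) (simp only: YB)
  moreover have "(\<Sum>s=1..views M. (frobenius_norm (transpose_mat Q * B s))\<^sup>2) =
      (\<Sum>s=1..views M. (frobenius_norm (B s))\<^sup>2)"
    by (rule sum.cong[OF refl]) (rule frobenius_norm_orthogonal_mult[OF B Q QQt])
  ultimately show ?thesis
    unfolding objective_def regularizer_def
    by (simp only: mat_trace_quadratic_form_orthogonal[OF Y L Q QQt]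
      frobenius_norm_mult_orthogonal[OF Y Q QQt])
qed

theorem mainTheorem1:
  fixes M :: multiplex
    and Q Y :: "real mat"
    and B :: "nat \<Rightarrow> real mat"
    and H :: "nat \<Rightarrow> autoencoder"
  assumes "multiplex_network M"
    and "Q \<in> carrier_mat (emb_dim M) (emb_dim M)"
    and "transpose_mat Q * Q = 1\<^sub>m (emb_dim M)"
    and "optimal_solution M Y B H"
  shows "optimal_solution M (Y * Q) (\<lambda>s. transpose_mat Q * B s) H"
proof -
  \<comment> \<open>For square matrices a one-sided inverse is two-sided; the invariance lemmas need
    the product in this order.\<close>
  have QQt: "Q * transpose_mat Q = 1\<^sub>m (emb_dim M)"
    using mat_mult_left_right_inverse[of "transpose_mat Q" "emb_dim M" Q] assms(2,3) by simp
  have adm: "admissible M Y B H"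
    using assms(4) by (simp add: optimal_solution_def is_arg_min_def)
  then have "admissible M (Y * Q) (\<lambda>s. transpose_mat Q * B s) H"
    using assms(2) by (auto simp: admissible_def)
  \<comment> \<open>\<open>is_arg_min\<close> asks for admissibility and that no admissible point
    has a strictly smaller value; the second condition carries over because both points have the
    same value.\<close>
  then show ?thesis
    using assms(4) objective_orthogonal_invariant[OF adm assms(2) QQt]
    by (simp add: optimal_solution_def is_arg_min_def)
qed

end
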